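(* Suppose that there exist measurable functions $L_n:\Theta_n\to(0,\infty)$, $n\in\mathbb{N}$, and a point $x_0\in X$ such that: (A1) for each $n\in\mathbb{N}$ and $\vartheta_n$-a.e. $\theta\in\Theta_n$, $\rho\big(S_\theta^{(n)}(x),S_\theta^{(n)}(y)\big)\le L_n(\theta)\rho(x,y)$ for any $x,y\in X$; (A2) for every $E\in\mathcal{B}((0,\infty))$, $\vartheta_n(L_n^{-1}(E))$ does not depend on $n$, and $R:=\int_{\Theta_1}L_1\,d\vartheta_1<\infty$, $\int_{\Theta_1}\ln L_1\,d\vartheta_1<0$; (A3') $\sup_{n\ge1}\int_{\Theta_n}\rho\big(x_0,S_\theta^{(n)}(x_0)\big)\,\vartheta_n(d\theta)<\infty$; and that $R<1$. Then the measure $\bar\pi\in\mathcal{M}_1(X)$ (which exists under (A1), (A2), (A3')) such that, for some $\bar q\in(0,1)$ and $\bar C\in[0,\infty)$, $$d_{BL}\big(\mu\bar P^{(n)},\bar\pi\big)\le\bar C\bar q^{\,n}\Big(1+\int_X\rho(x,x_0)\,\mu(dx)\Big)\quad\text{for any }\mu\in\mathcal{M}_{1,1}(X),\ n\in\mathbb{N},$$ belongs to $\mathcal{M}_{1,1}(X)$.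
   Context: Setting. $(X,\rho)$ is a Polish (complete separable) metric space with Borel $\sigma$-field $\mathcal{B}(X)$; $\{(\Theta_n,\mathcal{A}_n,\vartheta_n)\}_{n\in\mathbb{N}}$ is an arbitrary sequence of probability spaces; for each $n\in\mathbb{N}$, $\{S_\theta^{(n)}:\theta\in\Theta_n\}$ is a family of maps from $X$ into itself such that $X\times\Theta_n\ni(x,\theta)\mapsto S_\theta^{(n)}(x)\in X$ is $\mathcal{B}(X)\otimes\mathcal{A}_n/\mathcal{B}(X)$-measurable. Measures. $\mathcal{M}_1(X)$ is the set of Borel probability measures on $X$; $\mathcal{M}_{1,1}(X)$ is the set of $\mu\in\mathcal{M}_1(X)$ with $\int_X\rho(x,z)\,\mu(dx)<\infty$ for some (equivalently all) $z\in X$. $d_{BL}(\mu,\nu):=\sup|\int f\,d\mu-\int f\,d\nu|$, the supremum being over all $f:X\to[-1,1]$ that are Lipschitz with constant at most $1$. Kernels. $P_n(x,A):=\int_{\Theta_n}\mathbf{1}_A(S_\theta^{(n)}(x))\,\vartheta_n(d\theta)$; $\mu P_n(A):=\int_X P_n(x,A)\,\mu(dx)$; $\mu\bar P^{(n)}:=\mu P_nP_{n-1}\cdots P_1$ (apply $P_n$ first and $P_1$ last). *)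

theory Defs
  imports "HOL-Probability.Probability"
begin

abbreviation M1 :: "'a::topological_space measure set" where
  "M1 \<equiv> {\<mu>. prob_space \<mu> \<and> sets \<mu> = sets borel}"

definition M11 :: "'a::metric_space measure set" where
  "M11 = {\<mu> \<in> M1. \<exists>z. (\<integral>\<^sup>+ x. ennreal (dist x z) \<partial>\<mu>) < \<infinity>}"

definition dBL :: "'a::metric_space measure \<Rightarrow> 'a measure \<Rightarrow> real" where
  "dBL \<mu> \<nu> = (SUP f \<in> {f :: 'a \<Rightarrow> real. range f \<subseteq> {-1..1} \<and> 1-lipschitz_on UNIV f}.
     \<bar>(\<integral>x. f x \<partial>\<mu>) - (\<integral>x. f x \<partial>\<nu>)\<bar>)"

text \<open>Integral of a real function with values in the extended reals: unlike the Bochner integral,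
  which is 0 for non-integrable functions, it is \<open>-\<infinity>\<close> when only the negative part has infinite
  integral. When both parts have infinite integral the value is irrelevant (here \<open>\<infinity>\<close>).\<close>

definition ext_integral :: "'b measure \<Rightarrow> ('b \<Rightarrow> real) \<Rightarrow> ereal" where
  "ext_integral M f =
     enn2ereal (\<integral>\<^sup>+ t. ennreal (f t) \<partial>M) - enn2ereal (\<integral>\<^sup>+ t. ennreal (- f t) \<partial>M)"

definition trans_kernel ::
    "(nat \<Rightarrow> 't measure) \<Rightarrow> (nat \<Rightarrow> 't \<Rightarrow> 'a \<Rightarrow> 'a) \<Rightarrow> nat \<Rightarrow> 'a \<Rightarrow> 'a set \<Rightarrow> ennreal" where
  "trans_kernel \<Theta> S n x A = (\<integral>\<^sup>+ \<theta>. indicator A (S n \<theta> x) \<partial>\<Theta> n)"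

definition kernel_act :: "'a::topological_space measure \<Rightarrow> ('a \<Rightarrow> 'a set \<Rightarrow> ennreal) \<Rightarrow> 'a measure" where
  "kernel_act \<mu> P = measure_of UNIV (sets borel) (\<lambda>A. \<integral>\<^sup>+ x. P x A \<partial>\<mu>)"

text \<open>\<open>backward \<Theta> S n \<mu>\<close> is \<open>\<mu> P\<^sub>n P\<^sub>n\<^sub>-\<^sub>1 \<dots> P\<^sub>1\<close>: the kernel \<open>P\<^sub>n\<close> acts first. The data with
  index 0 are never used.\<close>

fun backward :: "(nat \<Rightarrow> 't measure) \<Rightarrow> (nat \<Rightarrow> 't \<Rightarrow> 'a \<Rightarrow> 'a) \<Rightarrow> nat
    \<Rightarrow> 'a::topological_space measure \<Rightarrow> 'a measure" where
  "backward \<Theta> S 0 \<mu> = \<mu>"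
| "backward \<Theta> S (Suc n) \<mu> = backward \<Theta> S n (kernel_act \<mu> (trans_kernel \<Theta> S (Suc n)))"

definition geometric_limit :: "(nat \<Rightarrow> 't measure) \<Rightarrow> (nat \<Rightarrow> 't \<Rightarrow> 'a \<Rightarrow> 'a) \<Rightarrow> 'a
    \<Rightarrow> 'a::metric_space measure \<Rightarrow> bool" where
  "geometric_limit \<Theta> S x0 \<pi> \<longleftrightarrow>
     (\<exists>q C. 0 < q \<and> q < 1 \<and> 0 \<le> C \<and>
        (\<forall>\<mu> \<in> M11. \<forall>n\<ge>1.
           dBL (backward \<Theta> S n \<mu>) \<pi> \<le> C * q ^ n * (1 + (\<integral>x. dist x x0 \<partial>\<mu>))))"

text \<open>\<open>measure_of\<close> collapses to the null measure if its argument is not countably additive; this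
  does not happen here.\<close>

lemma emeasure_kernel_act:
  fixes \<mu> :: "'a::polish_space measure"
  assumes \<mu>: "sets \<mu> = sets borel" and \<Theta>: "prob_space (\<Theta> n)"
    and S: "(\<lambda>(x, \<theta>). S n \<theta> x) \<in> borel \<Otimes>\<^sub>M \<Theta> n \<rightarrow>\<^sub>M borel"
    and A: "A \<in> sets borel"
  shows "emeasure (kernel_act \<mu> (trans_kernel \<Theta> S n)) A = (\<integral>\<^sup>+ x. trans_kernel \<Theta> S n x A \<partial>\<mu>)"
proof -
  interpret T: prob_space "\<Theta> n" by (fact \<Theta>)
  have S': "(\<lambda>p. S n (snd p) (fst p)) \<in> borel \<Otimes>\<^sub>M \<Theta> n \<rightarrow>\<^sub>M borel"
    using S by (simp add: case_prod_beta')
  have Sx: "(\<lambda>\<theta>. S n \<theta> x) \<in> \<Theta> n \<rightarrow>\<^sub>M borel" for x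
    using measurable_compose[OF _ S', of "\<lambda>\<theta>. (x, \<theta>)" "\<Theta> n"] by simp
  have meas: "(\<lambda>x. trans_kernel \<Theta> S n x B) \<in> borel_measurable \<mu>" if B: "B \<in> sets borel" for B
  proof -
    have "(\<lambda>p. indicator B (S n (snd p) (fst p)) :: ennreal) \<in> borel_measurable (borel \<Otimes>\<^sub>M \<Theta> n)"
      using measurable_compose[OF S' borel_measurable_indicator[OF B]] .
    then have "(\<lambda>x. trans_kernel \<Theta> S n x B) \<in> borel_measurable borel"
      unfolding trans_kernel_def
      by (intro T.borel_measurable_nn_integral) (simp add: case_prod_beta')
    then show ?thesis using measurable_cong_sets[OF \<mu> refl] by blast
  qed
  have suminf: "(\<Sum>i. trans_kernel \<Theta> S n x (F i)) = trans_kernel \<Theta> S n x (\<Union>i. F i)"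
    if "range F \<subseteq> sets borel" "disjoint_family F" for F x
  proof -
    have F: "F i \<in> sets borel" for i using that by auto
    have "trans_kernel \<Theta> S n x (\<Union>i. F i) = (\<integral>\<^sup>+ \<theta>. (\<Sum>i. indicator (F i) (S n \<theta> x)) \<partial>\<Theta> n)"
      unfolding trans_kernel_def using suminf_indicator[OF that(2)] by simp
    also have "\<dots> = (\<Sum>i. trans_kernel \<Theta> S n x (F i))"
      unfolding trans_kernel_def
      by (intro nn_integral_suminf measurable_compose[OF Sx borel_measurable_indicator[OF F]])
    finally show ?thesis by simp
  qed
  show ?thesis
    unfolding kernel_act_def
  proof (rule emeasure_measure_of_sigma)
    show "sigma_algebra UNIV (sets (borel :: 'a measure))"
      using sets.sigma_algebra_axioms[of "borel :: 'a measure"] by simp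
    show "positive (sets borel) (\<lambda>A. \<integral>\<^sup>+ x. trans_kernel \<Theta> S n x A \<partial>\<mu>)"
      by (simp add: positive_def trans_kernel_def)
    show "countably_additive (sets borel) (\<lambda>A. \<integral>\<^sup>+ x. trans_kernel \<Theta> S n x A \<partial>\<mu>)"
      unfolding countably_additive_def
      by (auto simp: nn_integral_suminf[symmetric] meas subset_eq suminf)
  qed (fact A)
qed

end

(*
  Let w be a sequence of independent parameters w(n) with law Theta(n+1), and put
  Y(n) = S1(w 0) (S2(w 1) (... Sn(w(n-1)) x0)), which has law (delta_x0) P_n ... P_1.
  Passing from Y(n) to Y(n+1) only changes the innermost argument, so
  E dist(Y(n), Y(n+1)) <= R^n B with B the supremum in (A3').
  As R < 1, Y(n) converges almost surely, to Y_lim say, and E dist(x0, Y_lim) <= B / (1 - R).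
  The law of Y_lim is the limit measure: the same coupling bounds the distance from any
  starting law. It is the only one, since bounded Lipschitz functions determine a measure.
*)

theory Submission
  imports Defs
begin

section \<open>Bounded Lipschitz functions\<close>

abbreviation BL1 :: "('a::metric_space \<Rightarrow> real) set" where
  "BL1 \<equiv> {f. range f \<subseteq> {-1..1} \<and> 1-lipschitz_on UNIV f}"

lemma BL1_abs_le: "f \<in> BL1 \<Longrightarrow> \<bar>f x\<bar> \<le> 1"
  by (auto simp: abs_le_iff image_subset_iff)

lemma BL1_diff_le: "f \<in> BL1 \<Longrightarrow> \<bar>f x - f y\<bar> \<le> dist x y"
  using lipschitz_onD[of 1 UNIV f x y] by (auto simp: dist_real_def)

lemma BL1_measurable: "f \<in> BL1 \<Longrightarrow> f \<in> borel_measurable borel"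
  by (auto intro: borel_measurable_continuous_onI lipschitz_on_continuous_on)

lemma BL1_integrable:
  assumes "prob_space \<mu>" "f \<in> BL1" and U: "U \<in> borel_measurable \<mu>"
  shows "integrable \<mu> (\<lambda>x. f (U x))"
proof -
  interpret prob_space \<mu> by fact
  show ?thesis
    using BL1_abs_le[OF assms(2)] measurable_compose[OF U BL1_measurable[OF assms(2)]]
    by (intro integrable_const_bound[where B = 1]) auto
qed

lemma BL1_expectation_le:
  assumes "prob_space \<mu>" "f \<in> BL1"
  shows "\<bar>\<integral>x. f x \<partial>\<mu>\<bar> \<le> 1"
proof -
  interpret prob_space \<mu> by fact
  have "\<bar>\<integral>x. f x \<partial>\<mu>\<bar> \<le> (\<integral>x. 1 \<partial>\<mu>)"
    using BL1_abs_le[OF assms(2)] by (intro integral_abs_bound[THEN order_trans] integral_mono') auto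
  then show ?thesis by (simp add: prob_space)
qed

text \<open>A real supremum dominates its members only if they are bounded above. Here 2 is a bound,
  as both expectations lie in [-1, 1].\<close>

lemma BL1_diff_le_dBL:
  assumes "prob_space \<mu>" "prob_space \<nu>" "f \<in> BL1"
  shows "\<bar>(\<integral>x. f x \<partial>\<mu>) - (\<integral>x. f x \<partial>\<nu>)\<bar> \<le> dBL \<mu> \<nu>"
  unfolding dBL_def
proof (rule cSUP_upper[OF assms(3)])
  show "bdd_above ((\<lambda>f. \<bar>(\<integral>x. f x \<partial>\<mu>) - (\<integral>x. f x \<partial>\<nu>)\<bar>) ` BL1)"
  proof (rule bdd_aboveI2)
    fix f :: "'a \<Rightarrow> real" assume "f \<in> BL1"
    then show "\<bar>(\<integral>x. f x \<partial>\<mu>) - (\<integral>x. f x \<partial>\<nu>)\<bar> \<le> 2"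
      using BL1_expectation_le[OF assms(1)] BL1_expectation_le[OF assms(2)] by (smt (verit))
  qed
qed

lemma BL1_zero: "(\<lambda>_. 0) \<in> BL1"
  by (auto intro!: lipschitz_onI)

text \<open>Coupling bound: with \<open>U\<close> and \<open>V\<close> on one space, replacing
  \<open>U z\<close> by \<open>V z\<close> changes a 1-Lipschitz test function by at most
  \<open>dist (U z) (V z)\<close>, so its two expectations differ by at most the mean
  distance.\<close>

lemma dBL_distr_le:
  fixes U V :: "'b \<Rightarrow> 'a::{metric_space, second_countable_topology}"
  assumes N: "prob_space N" and U[measurable]: "U \<in> borel_measurable N"
    and V[measurable]: "V \<in> borel_measurable N"
    and c: "0 \<le> c" "(\<integral>\<^sup>+ z. ennreal (dist (U z) (V z)) \<partial>N) \<le> ennreal c"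
  shows "dBL (distr N borel U) (distr N borel V) \<le> c"
  unfolding dBL_def
proof (rule cSUP_least)
  show "BL1 \<noteq> ({} :: ('a \<Rightarrow> real) set)" using BL1_zero by blast
  fix f :: "'a \<Rightarrow> real" assume f: "f \<in> BL1"
  have fm[measurable]: "f \<in> borel_measurable borel" by (rule BL1_measurable[OF f])
  have int: "integrable N (\<lambda>z. dist (U z) (V z))"
    using c(2) by (intro integrableI_bounded) (auto simp: le_less_trans)
  have "\<bar>(\<integral>x. f x \<partial>distr N borel U) - (\<integral>x. f x \<partial>distr N borel V)\<bar>
      = \<bar>\<integral>z. f (U z) - f (V z) \<partial>N\<bar>"
    using BL1_integrable[OF N f U] BL1_integrable[OF N f V] by (simp add: integral_distr)
  also have "\<dots> \<le> (\<integral>z. dist (U z) (V z) \<partial>N)"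
    using BL1_diff_le[OF f] int
    by (intro integral_abs_bound[THEN order_trans] integral_mono') auto
  also have "\<dots> \<le> c"
    using c(2) c(1) nn_integral_eq_integral[OF int] by simp
  finally show "\<bar>(\<integral>x. f x \<partial>distr N borel U) - (\<integral>x. f x \<partial>distr N borel V)\<bar> \<le> c" .
qed

text \<open>The reference point \<open>z\<close> from the definition of \<open>M11\<close> can be
  exchanged for any \<open>y\<close> by the triangle inequality, since constants are integrable for
  a probability measure.\<close>

lemma M11_integrable:
  fixes \<mu> :: "'a::{metric_space, second_countable_topology} measure"
  assumes "\<mu> \<in> M11"
  shows "integrable \<mu> (\<lambda>x. dist x y)"
proof -
  have s[measurable_cong]: "sets \<mu> = sets borel" and p: "prob_space \<mu>"
    using assms by (auto simp: M11_def)
  interpret prob_space \<mu> by (rule p)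
  obtain z where z: "(\<integral>\<^sup>+ x. ennreal (dist x z) \<partial>\<mu>) < \<infinity>"
    using assms by (auto simp: M11_def)
  have m: "(\<lambda>x. dist x y) \<in> borel_measurable \<mu>" for y
    by measurable
  have "integrable \<mu> (\<lambda>x. dist x z)"
    using z m by (intro integrableI_bounded) auto
  then have "integrable \<mu> (\<lambda>x. dist x z + dist z y)" by simp
  then show ?thesis
    by (rule Bochner_Integration.integrable_bound) (auto intro: dist_triangle m)
qed

section \<open>Bounded Lipschitz functions determine a probability measure\<close>

text \<open>Divided by \<open>e\<close>, these functions approximate the indicator of a closed set
  from above as \<open>e\<close> tends to 0. The division is left out to keep the Lipschitz constant
  1; \<open>e \<le> 1\<close> keeps the values in [-1, 1].\<close>

lemma truncated_infdist_in_BL1: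
  assumes "0 < e" "e \<le> 1"
  shows "(\<lambda>x. max 0 (e - infdist x A)) \<in> BL1"
proof -
  have "\<bar>max 0 (e - infdist x A) - max 0 (e - infdist y A)\<bar> \<le> dist x y" for x y
    using infdist_triangle_abs[of x A y] by linarith
  then show ?thesis
    using assms infdist_nonneg[of _ A]
    by (auto intro!: lipschitz_onI simp: dist_real_def) (smt (verit))+
qed

text \<open>Closed sets are an intersection-stable generator of the Borel sets, and the mass of a
  nonempty closed set is a limit of rescaled integrals of functions in \<open>BL1\<close>.\<close>

lemma measure_eqI_BL1:
  fixes \<mu> \<nu> :: "'a::metric_space measure"
  assumes \<mu>: "\<mu> \<in> M1" and \<nu>: "\<nu> \<in> M1"
    and eq: "\<And>f. f \<in> BL1 \<Longrightarrow> (\<integral>x. f x \<partial>\<mu>) = (\<integral>x. f x \<partial>\<nu>)"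
  shows "\<mu> = \<nu>"
proof -
  interpret \<mu>: prob_space \<mu> using \<mu> by simp
  interpret \<nu>: prob_space \<nu> using \<nu> by simp
  have lim: "(\<lambda>k. real (Suc k) * (\<integral>x. max 0 (1 / real (Suc k) - infdist x A) \<partial>\<kappa>))
      \<longlonglongrightarrow> measure \<kappa> A"
    if \<kappa>: "\<kappa> \<in> M1" and A: "closed A" "A \<noteq> {}" for \<kappa> :: "'a measure" and A
  proof -
    interpret \<kappa>: prob_space \<kappa> using \<kappa> by simp
    have s[measurable_cong]: "sets \<kappa> = sets borel" using \<kappa> by simp
    have m: "(\<lambda>x. max 0 (1 / real (Suc k) - infdist x A)) \<in> borel_measurable \<kappa>" for k
      using BL1_measurable[OF truncated_infdist_in_BL1[of "1 / real (Suc k)" A]]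
        measurable_cong_sets[OF s refl] by auto
    have "(\<lambda>k. \<integral>x. real (Suc k) * max 0 (1 / real (Suc k) - infdist x A) \<partial>\<kappa>)
        \<longlonglongrightarrow> (\<integral>x. indicator A x \<partial>\<kappa>)"
    proof (rule integral_dominated_convergence[where w = "\<lambda>_. 1"])
      show "AE x in \<kappa>. (\<lambda>k. real (Suc k) * max 0 (1 / real (Suc k) - infdist x A))
          \<longlonglongrightarrow> indicator A x"
      proof (rule AE_I2)
        fix x
        show "(\<lambda>k. real (Suc k) * max 0 (1 / real (Suc k) - infdist x A)) \<longlonglongrightarrow> indicator A x"
        \<comment> \<open>On \<open>A\<close> all terms equal 1. Off \<open>A\<close>, closedness
          makes the distance positive, and the terms vanish once 1 / (k + 1) is below it.\<close>
        proof (cases "x \<in> A")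
          case True
          then show ?thesis by simp
        next
          case False
          then have "0 < infdist x A"
            using in_closed_iff_infdist_zero[OF A] infdist_nonneg[of x A] by fastforce
          then have "\<forall>\<^sub>F k in sequentially. 1 / real (Suc k) < infdist x A"
            using LIMSEQ_inverse_real_of_nat
            by (intro order_tendstoD(2)[of _ 0]) (auto simp: inverse_eq_divide)
          then have "\<forall>\<^sub>F k in sequentially.
              real (Suc k) * max 0 (1 / real (Suc k) - infdist x A) = indicator A x"
            by eventually_elim (use False in auto)
          then show ?thesis by (rule tendsto_eventually)
        qed
      qed
      show "AE x in \<kappa>. norm (real (Suc k) * max 0 (1 / real (Suc k) - infdist x A)) \<le> 1" for k
      proof (rule AE_I2)
        fix x
        have "max 0 (1 / real (Suc k) - infdist x A) \<le> 1 / real (Suc k)"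
          using infdist_nonneg[of x A] by simp
        then have "real (Suc k) * max 0 (1 / real (Suc k) - infdist x A) \<le> real (Suc k) * (1 / real (Suc k))"
          by (rule mult_left_mono) simp
        then show "norm (real (Suc k) * max 0 (1 / real (Suc k) - infdist x A)) \<le> 1"
          by (simp add: abs_mult)
      qed
      show "(\<lambda>x. real (Suc k) * max 0 (1 / real (Suc k) - infdist x A)) \<in> borel_measurable \<kappa>" for k
        using m[of k] by simp
      show "(indicator A :: 'a \<Rightarrow> real) \<in> borel_measurable \<kappa>"
        using A s by (intro borel_measurable_indicator) simp
    qed simp
    then show ?thesis by (simp add: s A space_borel sets_eq_imp_space_eq[OF s])
  qed
  have closed: "emeasure \<mu> A = emeasure \<nu> A" if A: "closed A" for A
  \<comment> \<open>The empty set is treated apart: \<open>infdist x {}\<close> is 0 by convention,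
    so the approximations would be constantly 1.\<close>
  proof (cases "A = {}")
    case False
    have "(\<integral>x. max 0 (1 / real (Suc k) - infdist x A) \<partial>\<mu>)
        = (\<integral>x. max 0 (1 / real (Suc k) - infdist x A) \<partial>\<nu>)" for k
      by (intro eq truncated_infdist_in_BL1) auto
    then have "measure \<mu> A = measure \<nu> A"
      using LIMSEQ_unique[OF lim[OF \<mu> A False]] lim[OF \<nu> A False] by simp
    then show ?thesis by (simp add: \<mu>.emeasure_eq_measure \<nu>.emeasure_eq_measure)
  qed simp
  show ?thesis
  proof (rule measure_eqI_generator_eq[where E = "Collect closed" and \<Omega> = UNIV and A = "\<lambda>_. UNIV"])
    show "Int_stable (Collect closed :: 'a set set)" by (auto simp: Int_stable_def)
    show "sets \<mu> = sigma_sets UNIV (Collect closed)" "sets \<nu> = sigma_sets UNIV (Collect closed)"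
      using \<mu> \<nu> by (auto simp: borel_eq_closed)
  qed (auto simp: closed)
qed

section \<open>Sequences with summable steps\<close>

lemma dist_le_sum_dist:
  fixes y :: "nat \<Rightarrow> 'b::metric_space"
  shows "dist (y n) (y (n + m)) \<le> (\<Sum>k<m. dist (y (n + k)) (y (Suc (n + k))))"
proof (induction m)
  case (Suc m)
  then show ?case
    using dist_triangle[of "y n" "y (n + Suc m)" "y (n + m)"] by simp
qed simp

lemma Cauchy_if_summable_dist:
  fixes y :: "nat \<Rightarrow> 'b::metric_space"
  assumes "summable (\<lambda>k. dist (y k) (y (Suc k)))"
  shows "Cauchy y"
proof (rule metric_CauchyI)
  fix e :: real assume "0 < e"
  then obtain N where N: "\<And>m n. m \<ge> N \<Longrightarrow> norm (\<Sum>k=m..<n. dist (y k) (y (Suc k))) < e"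
    using assms unfolding summable_Cauchy by blast
  have le: "dist (y m) (y n) < e" if "N \<le> m" "m \<le> n" for m n
  proof -
    have "dist (y m) (y n) \<le> (\<Sum>k<n - m. dist (y (m + k)) (y (Suc (m + k))))"
      using dist_le_sum_dist[of y m "n - m"] that by simp
    also have "\<dots> = (\<Sum>k=m..<n. dist (y k) (y (Suc k)))"
      using sum.shift_bounds_nat_ivl[of "\<lambda>k. dist (y k) (y (Suc k))" 0 m "n - m"] that
      by (simp add: atLeast0LessThan add.commute)
    also have "\<dots> < e" using N[OF that(1), of n] by simp
    finally show ?thesis .
  qed
  show "\<exists>N. \<forall>m\<ge>N. \<forall>n\<ge>N. dist (y m) (y n) < e"
    using le by (metis dist_commute nle_le)
qed

lemma emeasure_distr_eq_nn_integral:
  assumes "h \<in> N \<rightarrow>\<^sub>M N'" "A \<in> sets N'"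
  shows "emeasure (distr N N' h) A = (\<integral>\<^sup>+ z. indicator A (h z) \<partial>N)"
  using assms by (simp add: nn_integral_distr nn_integral_indicator[symmetric] del: nn_integral_indicator)

section \<open>Random composition of contracting maps\<close>

text \<open>The maps are numbered from 1 and the coordinates of the sample from 0: coordinate \<open>n\<close> drives map \<open>n + 1\<close>.\<close>

primrec backward_map :: "(nat \<Rightarrow> 't \<Rightarrow> 'a \<Rightarrow> 'a) \<Rightarrow> nat \<Rightarrow> (nat \<Rightarrow> 't) \<Rightarrow> 'a \<Rightarrow> 'a" where
  "backward_map S 0 w x = x"
| "backward_map S (Suc n) w x = backward_map S n w (S (Suc n) (w n) x)"

text \<open>The composition of the first \<open>n\<close> maps reads only the coordinates below
  \<open>n\<close>. Coordinate \<open>n\<close>, which drives the next map, is therefore independent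
  of it.\<close>

lemma backward_map_upd: "n \<le> m \<Longrightarrow> backward_map S n (w(m := \<theta>)) x = backward_map S n w x"
  by (induction n arbitrary: x) auto

text \<open>\<open>contraction\<close> is the Lipschitz bound of (A1) integrated over the parameter,
  with \<open>R\<close> the common mean of the Lipschitz constants; \<open>displacement\<close> is
  (A3'). Indices are written \<open>Suc n\<close> because the maps are numbered from 1.\<close>

locale contracting_on_average =
  fixes \<Theta> :: "nat \<Rightarrow> 't measure"
    and S :: "nat \<Rightarrow> 't \<Rightarrow> 'a::polish_space \<Rightarrow> 'a"
    and R B :: real
    and x0 :: 'a
  assumes prob: "prob_space (\<Theta> (Suc n))"
    and S_meas: "(\<lambda>(x, \<theta>). S (Suc n) \<theta> x) \<in> borel \<Otimes>\<^sub>M \<Theta> (Suc n) \<rightarrow>\<^sub>M borel"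
    and R: "0 \<le> R" "R < 1"
    and B: "0 \<le> B"
    and contraction:
      "(\<integral>\<^sup>+ \<theta>. ennreal (dist (S (Suc n) \<theta> x) (S (Suc n) \<theta> y)) \<partial>\<Theta> (Suc n)) \<le> ennreal (R * dist x y)"
    and displacement: "(\<integral>\<^sup>+ \<theta>. ennreal (dist x0 (S (Suc n) \<theta> x0)) \<partial>\<Theta> (Suc n)) \<le> ennreal B"
begin

section \<open>The product space of parameters and independence\<close>

definition P :: "(nat \<Rightarrow> 't) measure" where
  "P = PiM UNIV (\<lambda>i. \<Theta> (Suc i))"

sublocale \<Theta>: prob_space "\<Theta> (Suc n)" for n
  by (rule prob)

sublocale P: prob_space P
  unfolding P_def by (intro prob_space_PiM prob)

lemma S_measurable[measurable (raw)]:
  assumes "f \<in> N \<rightarrow>\<^sub>M borel" "g \<in> N \<rightarrow>\<^sub>M \<Theta> (Suc n)"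
  shows "(\<lambda>z. S (Suc n) (g z) (f z)) \<in> N \<rightarrow>\<^sub>M borel"
  using measurable_compose[OF measurable_Pair[OF assms] S_meas[of n]] by simp

lemma coord_measurable: "(\<lambda>w. w n) \<in> P \<rightarrow>\<^sub>M \<Theta> (Suc n)"
  unfolding P_def by (rule measurable_component_singleton) simp

lemma backward_map_measurable[measurable (raw)]:
  assumes "f \<in> N \<rightarrow>\<^sub>M borel" "g \<in> N \<rightarrow>\<^sub>M P"
  shows "(\<lambda>z. backward_map S n (g z) (f z)) \<in> N \<rightarrow>\<^sub>M borel"
  using assms(1)
proof (induction n arbitrary: f)
  case (Suc n)
  show ?case
    using Suc.IH[OF S_measurable[OF Suc.prems measurable_compose[OF assms(2) coord_measurable]]]
    by simp
qed simp

text \<open>The library fact adjoins a coordinate \<open>n\<close> to an index set. As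
  \<open>n\<close> already lies in \<open>UNIV\<close>, adjoining it amounts to redrawing
  it.\<close>

lemma resample: "distr (\<Theta> (Suc n) \<Otimes>\<^sub>M P) P (\<lambda>(\<theta>, w). w(n := \<theta>)) = P"
  using distr_pair_PiM_eq_PiM[of UNIV "\<lambda>i. \<Theta> (Suc i)" n] prob by (simp add: P_def)

lemma resample_measurable: "(\<lambda>(\<theta>, w). w(n := \<theta>)) \<in> \<Theta> (Suc n) \<Otimes>\<^sub>M P \<rightarrow>\<^sub>M P"
  using measurable_compose[OF measurable_pair_swap'[of "\<Theta> (Suc n)"]
      measurable_add_dim[of n UNIV "\<lambda>i. \<Theta> (Suc i)"]]
  by (simp add: P_def case_prod_beta')

text \<open>This is how independence is used below. After redrawing coordinate \<open>n\<close> as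
  \<open>\<theta>\<close> the integrand is \<open>h \<theta> (w(n := \<theta>))\<close>, which
  equals \<open>h \<theta> w\<close> by \<open>fresh\<close>; Fubini then separates the two
  integrals.\<close>

lemma nn_integral_fresh_coordinate:
  assumes h: "case_prod h \<in> borel_measurable (\<Theta> (Suc n) \<Otimes>\<^sub>M P)"
    and fresh: "\<And>\<theta> \<theta>' w. h \<theta> (w(n := \<theta>')) = h \<theta> w"
  shows "(\<integral>\<^sup>+ w. h (w n) w \<partial>P) = (\<integral>\<^sup>+ \<theta>. \<integral>\<^sup>+ w. h \<theta> w \<partial>P \<partial>\<Theta> (Suc n))"
proof -
  have m: "(\<lambda>w. h (w n) w) \<in> borel_measurable P"
    using measurable_compose[OF measurable_Pair[OF coord_measurable measurable_ident] h] by simp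
  have "(\<integral>\<^sup>+ w. h (w n) w \<partial>P)
      = (\<integral>\<^sup>+ z. (\<lambda>w. h (w n) w) ((\<lambda>(\<theta>, w). w(n := \<theta>)) z) \<partial>(\<Theta> (Suc n) \<Otimes>\<^sub>M P))"
    by (subst resample[of n, symmetric]) (simp add: nn_integral_distr resample_measurable m)
  also have "\<dots> = (\<integral>\<^sup>+ z. case_prod h z \<partial>(\<Theta> (Suc n) \<Otimes>\<^sub>M P))"
    by (simp add: case_prod_beta' fresh)
  also have "\<dots> = (\<integral>\<^sup>+ \<theta>. \<integral>\<^sup>+ w. h \<theta> w \<partial>P \<partial>\<Theta> (Suc n))"
    using P.nn_integral_fst[OF h] by simp
  finally show ?thesis .
qed

section \<open>Laws of the iterates as push-forwards\<close>

text \<open>By Fubini, one step of the kernel is a random map applied to an independent starting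
  point. This replaces the set function inside \<open>measure_of\<close> by a push-forward.\<close>

lemma kernel_act_eq_distr:
  assumes "\<mu> \<in> M1"
  shows "kernel_act \<mu> (trans_kernel \<Theta> S (Suc n))
    = distr (\<mu> \<Otimes>\<^sub>M \<Theta> (Suc n)) borel (\<lambda>(x, \<theta>). S (Suc n) \<theta> x)" (is "?K = ?D")
proof (rule measure_eqI)
  have s[measurable_cong]: "sets \<mu> = sets borel" using assms by simp
  show sets: "sets ?K = sets ?D"
    using sets.sigma_sets_eq[of "borel :: 'a measure"] by (simp add: kernel_act_def)
  fix A assume "A \<in> sets ?K"
  then have A[measurable]: "A \<in> sets borel" by (simp add: sets)
  have "emeasure ?K A = (\<integral>\<^sup>+ x. \<integral>\<^sup>+ \<theta>. indicator A (S (Suc n) \<theta> x) \<partial>\<Theta> (Suc n) \<partial>\<mu>)"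
    using emeasure_kernel_act[where \<Theta> = \<Theta> and S = S and n = "Suc n", OF s prob S_meas A] by (simp add: trans_kernel_def)
  also have "\<dots> = (\<integral>\<^sup>+ z. indicator A (S (Suc n) (snd z) (fst z)) \<partial>(\<mu> \<Otimes>\<^sub>M \<Theta> (Suc n)))"
    by (subst \<Theta>.nn_integral_fst[symmetric]) auto
  also have "\<dots> = emeasure ?D A"
    by (subst emeasure_distr_eq_nn_integral) (auto simp: case_prod_beta')
  finally show "emeasure ?K A = emeasure ?D A" .
qed

text \<open>Both recursions remove the step that acts first: \<open>backward\<close> changes the
  starting law, \<open>backward_map\<close> the starting point. The induction therefore runs over
  all \<open>\<mu>\<close>.\<close>

lemma backward_eq_distr:
  assumes "\<mu> \<in> M1"
  shows "backward \<Theta> S n \<mu> = distr (\<mu> \<Otimes>\<^sub>M P) borel (\<lambda>(x, w). backward_map S n w x)"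
  using assms
proof (induction n arbitrary: \<mu>)
  case 0
  have s[measurable_cong]: "sets \<mu> = sets borel" using 0 by simp
  have "distr (\<mu> \<Otimes>\<^sub>M P) borel fst = distr (\<mu> \<Otimes>\<^sub>M P) \<mu> fst"
    by (rule distr_cong) (auto simp: s)
  also have "\<dots> = \<mu>"
    by (simp add: P.distr_pair_fst P.emeasure_space_1)
  finally show ?case by (simp add: case_prod_beta' fst_def[symmetric])
next
  case (Suc n)
  have s[measurable_cong]: "sets \<mu> = sets borel" using Suc.prems by simp
  \<comment> \<open>The law after the first step, made by map \<open>n + 1\<close>; the induction
    hypothesis is applied to it in place of \<open>\<mu>\<close>.\<close>
  let ?K = "distr (\<mu> \<Otimes>\<^sub>M \<Theta> (Suc n)) borel (\<lambda>(x, \<theta>). S (Suc n) \<theta> x)"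
  have K: "?K \<in> M1"
    using prob_space.prob_space_distr[OF prob_space_pair[OF _ prob[of n], of \<mu>],
        of "\<lambda>(x, \<theta>). S (Suc n) \<theta> x" borel] Suc.prems
    by (simp add: case_prod_beta')
  show ?case
  proof (rule measure_eqI)
    fix A assume "A \<in> sets (backward \<Theta> S (Suc n) \<mu>)"
    then have A[measurable]: "A \<in> sets borel"
      by (simp add: kernel_act_eq_distr[OF Suc.prems] Suc.IH[OF K])
    have "emeasure (backward \<Theta> S (Suc n) \<mu>) A
        = (\<integral>\<^sup>+ z. indicator A (backward_map S n (snd z) (fst z)) \<partial>(?K \<Otimes>\<^sub>M P))"
      unfolding backward.simps kernel_act_eq_distr[OF Suc.prems] Suc.IH[OF K]
      by (subst emeasure_distr_eq_nn_integral) (auto simp: case_prod_beta')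
    also have "\<dots> = (\<integral>\<^sup>+ y. \<integral>\<^sup>+ w. indicator A (backward_map S n w y) \<partial>P \<partial>?K)"
      by (subst P.nn_integral_fst[symmetric]) auto
    also have "\<dots> = (\<integral>\<^sup>+ z. \<integral>\<^sup>+ w. indicator A (backward_map S n w (S (Suc n) (snd z) (fst z))) \<partial>P
        \<partial>(\<mu> \<Otimes>\<^sub>M \<Theta> (Suc n)))"
      by (subst nn_integral_distr) (auto simp: case_prod_beta')
    also have "\<dots> = (\<integral>\<^sup>+ x. \<integral>\<^sup>+ \<theta>. \<integral>\<^sup>+ w. indicator A (backward_map S n w (S (Suc n) \<theta> x))
        \<partial>P \<partial>\<Theta> (Suc n) \<partial>\<mu>)"
      by (subst \<Theta>.nn_integral_fst[symmetric]) auto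
    \<comment> \<open>The separate parameter \<open>\<theta>\<close> becomes coordinate
      \<open>n\<close> of the sample, which the remaining \<open>n\<close> maps do not read.\<close>
    also have "\<dots> = (\<integral>\<^sup>+ x. \<integral>\<^sup>+ w. indicator A (backward_map S (Suc n) w x) \<partial>P \<partial>\<mu>)"
      by (intro nn_integral_cong, subst nn_integral_fresh_coordinate[symmetric])
        (auto simp: backward_map_upd)
    also have "\<dots> = (\<integral>\<^sup>+ z. indicator A (backward_map S (Suc n) (snd z) (fst z)) \<partial>(\<mu> \<Otimes>\<^sub>M P))"
      by (subst P.nn_integral_fst[symmetric]) (auto simp del: backward_map.simps)
    also have "\<dots> = emeasure (distr (\<mu> \<Otimes>\<^sub>M P) borel (\<lambda>(x, w). backward_map S (Suc n) w x)) A"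
      by (subst emeasure_distr_eq_nn_integral) (auto simp: case_prod_beta' simp del: backward_map.simps)
    finally show "emeasure (backward \<Theta> S (Suc n) \<mu>) A
        = emeasure (distr (\<mu> \<Otimes>\<^sub>M P) borel (\<lambda>(x, w). backward_map S (Suc n) w x)) A" .
  qed (simp add: kernel_act_eq_distr[OF Suc.prems] Suc.IH[OF K])
qed

lemma backward_in_M1: "\<mu> \<in> M1 \<Longrightarrow> backward \<Theta> S n \<mu> \<in> M1"
  using prob_space.prob_space_distr[OF prob_space_pair[OF _ P.prob_space_axioms],
      of \<mu> "\<lambda>(x, w). backward_map S n w x" borel]
  by (auto simp: backward_eq_distr measurable_split_conv)

section \<open>Mean contraction and almost sure convergence\<close>

text \<open>Given the fresh coordinate \<open>n\<close>, the outer \<open>n\<close> maps contract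
  the two image points by \<open>R ^ n\<close> on average, by induction over all pairs of points.
  Averaging over that coordinate gives the last factor \<open>R\<close>.\<close>

lemma nn_integral_dist_backward_map_le:
  "(\<integral>\<^sup>+ w. ennreal (dist (backward_map S n w x) (backward_map S n w y)) \<partial>P)
    \<le> ennreal (R ^ n * dist x y)"
proof (induction n arbitrary: x y)
  case 0
  then show ?case by (simp add: P.emeasure_space_1)
next
  case (Suc n)
  have "(\<integral>\<^sup>+ w. ennreal (dist (backward_map S (Suc n) w x) (backward_map S (Suc n) w y)) \<partial>P)
      = (\<integral>\<^sup>+ \<theta>. \<integral>\<^sup>+ w. ennreal (dist (backward_map S n w (S (Suc n) \<theta> x))
          (backward_map S n w (S (Suc n) \<theta> y))) \<partial>P \<partial>\<Theta> (Suc n))"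
    by (subst nn_integral_fresh_coordinate[symmetric]) (auto simp: backward_map_upd)
  also have "\<dots> \<le> (\<integral>\<^sup>+ \<theta>. ennreal (R ^ n) * ennreal (dist (S (Suc n) \<theta> x) (S (Suc n) \<theta> y)) \<partial>\<Theta> (Suc n))"
    using Suc.IH R by (intro nn_integral_mono) (simp add: ennreal_mult)
  also have "\<dots> = ennreal (R ^ n) * (\<integral>\<^sup>+ \<theta>. ennreal (dist (S (Suc n) \<theta> x) (S (Suc n) \<theta> y)) \<partial>\<Theta> (Suc n))"
    by (rule nn_integral_cmult) measurable
  also have "\<dots> \<le> ennreal (R ^ n) * ennreal (R * dist x y)"
    by (intro mult_left_mono contraction) simp
  also have "\<dots> = ennreal (R ^ Suc n * dist x y)"
    using R by (simp add: ennreal_mult[symmetric] mult_ac)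
  finally show ?case .
qed

definition Y :: "nat \<Rightarrow> (nat \<Rightarrow> 't) \<Rightarrow> 'a" where
  "Y n w = backward_map S n w x0"

lemma Y_measurable[measurable]: "Y n \<in> borel_measurable P"
  unfolding Y_def by measurable

text \<open>The same \<open>n\<close> maps are applied to \<open>x0\<close> and to
  \<open>S (Suc n) (w n) x0\<close>. Given \<open>w n\<close>, they contract by \<open>R ^ n\<close>
  on average, and the mean distance of these two points is at most \<open>B\<close>.\<close>

lemma nn_integral_dist_Y_Suc_le:
  "(\<integral>\<^sup>+ w. ennreal (dist (Y n w) (Y (Suc n) w)) \<partial>P) \<le> ennreal (R ^ n * B)"
proof -
  have "(\<integral>\<^sup>+ w. ennreal (dist (Y n w) (Y (Suc n) w)) \<partial>P)
      = (\<integral>\<^sup>+ \<theta>. \<integral>\<^sup>+ w. ennreal (dist (backward_map S n w x0)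
          (backward_map S n w (S (Suc n) \<theta> x0))) \<partial>P \<partial>\<Theta> (Suc n))"
    unfolding Y_def
    by (subst nn_integral_fresh_coordinate[symmetric]) (auto simp: backward_map_upd)
  also have "\<dots> \<le> (\<integral>\<^sup>+ \<theta>. ennreal (R ^ n) * ennreal (dist x0 (S (Suc n) \<theta> x0)) \<partial>\<Theta> (Suc n))"
    using R by (intro nn_integral_mono order_trans[OF nn_integral_dist_backward_map_le])
      (simp add: ennreal_mult)
  also have "\<dots> = ennreal (R ^ n) * (\<integral>\<^sup>+ \<theta>. ennreal (dist x0 (S (Suc n) \<theta> x0)) \<partial>\<Theta> (Suc n))"
    by (rule nn_integral_cmult) measurable
  also have "\<dots> \<le> ennreal (R ^ n) * ennreal B"
    by (intro mult_left_mono displacement) simp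
  also have "\<dots> = ennreal (R ^ n * B)"
    using R B by (simp add: ennreal_mult)
  finally show ?thesis .
qed

text \<open>A geometric series. The case \<open>n = 0\<close> gives almost sure convergence, general
  \<open>n\<close> the rate.\<close>

lemma nn_integral_suminf_dist_Y_le:
  "(\<integral>\<^sup>+ w. (\<Sum>k. ennreal (dist (Y (n + k) w) (Y (Suc (n + k)) w))) \<partial>P) \<le> ennreal (R ^ n * (B / (1 - R)))"
proof -
  have "(\<integral>\<^sup>+ w. (\<Sum>k. ennreal (dist (Y (n + k) w) (Y (Suc (n + k)) w))) \<partial>P)
      = (\<Sum>k. \<integral>\<^sup>+ w. ennreal (dist (Y (n + k) w) (Y (Suc (n + k)) w)) \<partial>P)"
    by (rule nn_integral_suminf) measurable
  also have "\<dots> \<le> (\<Sum>k. ennreal (R ^ (n + k) * B))"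
    by (intro suminf_le nn_integral_dist_Y_Suc_le) auto
  also have "\<dots> = ennreal (\<Sum>k. R ^ n * B * R ^ k)"
    using R B summable_mult[OF summable_geometric[of R], of "R ^ n * B"]
    by (subst suminf_ennreal2[symmetric]) (auto simp: power_add mult_ac)
  also have "(\<Sum>k. R ^ n * B * R ^ k) = R ^ n * (B / (1 - R))"
    using R by (simp add: suminf_mult suminf_geometric summable_geometric)
  finally show ?thesis .
qed

text \<open>Where \<open>Y\<close> is not Cauchy, the constant sequence \<open>x0\<close> takes its
  place. By completeness the modified sequence converges everywhere, so the limit is measurable as a
  pointwise limit.\<close>

definition Y_lim :: "(nat \<Rightarrow> 't) \<Rightarrow> 'a" where
  "Y_lim w = lim (\<lambda>n. if Cauchy (\<lambda>i. Y i w) then Y n w else x0)"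

lemma Y_lim_measurable[measurable]: "Y_lim \<in> borel_measurable P"
proof (rule borel_measurable_LIMSEQ_metric)
  show "(\<lambda>w. if Cauchy (\<lambda>i. Y i w) then Y n w else x0) \<in> borel_measurable P" for n
    by measurable
  show "(\<lambda>n. if Cauchy (\<lambda>i. Y i w) then Y n w else x0) \<longlonglongrightarrow> Y_lim w" for w
    by (cases "Cauchy (\<lambda>i. Y i w)")
      (simp_all add: Y_lim_def Cauchy_convergent_iff convergent_LIMSEQ_iff)
qed

text \<open>The total length of the steps has finite mean, hence is almost surely finite, and then
  the sequence is Cauchy.\<close>

lemma AE_Y_tendsto: "AE w in P. (\<lambda>n. Y n w) \<longlonglongrightarrow> Y_lim w"
proof -
  have "(\<integral>\<^sup>+ w. (\<Sum>k. ennreal (dist (Y k w) (Y (Suc k) w))) \<partial>P) \<noteq> \<infinity>"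
    using nn_integral_suminf_dist_Y_le[of 0] by (auto simp: top_unique)
  then have "AE w in P. (\<Sum>k. ennreal (dist (Y k w) (Y (Suc k) w))) \<noteq> \<infinity>"
    by (intro nn_integral_PInf_AE) auto
  then show ?thesis
  proof eventually_elim
    case (elim w)
    then have "summable (\<lambda>k. dist (Y k w) (Y (Suc k) w))"
      by (intro summable_suminf_not_top) auto
    then have "Cauchy (\<lambda>n. Y n w)" by (rule Cauchy_if_summable_dist)
    then show ?case
      by (simp add: Y_lim_def convergent_LIMSEQ_iff[symmetric] Cauchy_convergent_iff)
  qed
qed

text \<open>Almost surely the distance to the limit is at most the sum of the remaining steps: let
  \<open>m\<close> tend to infinity in the triangle inequality for \<open>Y n\<close> and
  \<open>Y (n + m)\<close>.\<close>

lemma nn_integral_dist_Y_lim_le: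
  "(\<integral>\<^sup>+ w. ennreal (dist (Y n w) (Y_lim w)) \<partial>P) \<le> ennreal (R ^ n * (B / (1 - R)))"
proof (rule order_trans[OF nn_integral_mono_AE nn_integral_suminf_dist_Y_le])
  show "AE w in P. ennreal (dist (Y n w) (Y_lim w))
      \<le> (\<Sum>k. ennreal (dist (Y (n + k) w) (Y (Suc (n + k)) w)))"
    using AE_Y_tendsto
  proof eventually_elim
    case (elim w)
    have lim: "(\<lambda>m. ennreal (dist (Y n w) (Y (n + m) w))) \<longlonglongrightarrow> ennreal (dist (Y n w) (Y_lim w))"
      using LIMSEQ_ignore_initial_segment[OF elim, of n]
      by (intro tendsto_ennrealI tendsto_dist tendsto_const) (simp add: add.commute)
    have "ennreal (dist (Y n w) (Y (n + m) w))
        \<le> (\<Sum>k. ennreal (dist (Y (n + k) w) (Y (Suc (n + k)) w)))" for m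
    proof -
      have "ennreal (dist (Y n w) (Y (n + m) w))
          \<le> (\<Sum>k<m. ennreal (dist (Y (n + k) w) (Y (Suc (n + k)) w)))"
        using dist_le_sum_dist[of "\<lambda>n. Y n w" n m] by (simp add: sum_ennreal ennreal_leI)
      also have "\<dots> \<le> (\<Sum>k. ennreal (dist (Y (n + k) w) (Y (Suc (n + k)) w)))"
        by (rule sum_le_suminf) auto
      finally show ?thesis .
    qed
    then show ?case using LIMSEQ_le_const2[OF lim] by blast
  qed
qed

section \<open>The limit law, its first moment and the rate\<close>

definition \<pi>_lim :: "'a measure" where
  "\<pi>_lim = distr P borel Y_lim"

lemma \<pi>_lim_in_M1: "\<pi>_lim \<in> M1"
  unfolding \<pi>_lim_def by (simp add: P.prob_space_distr)

text \<open>\<open>Y 0\<close> is constantly \<open>x0\<close>, so the case \<open>n = 0\<close> of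
  the distance bound is a bound on the first moment.\<close>

lemma \<pi>_lim_in_M11: "\<pi>_lim \<in> M11"
proof -
  have "(\<integral>\<^sup>+ x. ennreal (dist x x0) \<partial>\<pi>_lim) = (\<integral>\<^sup>+ w. ennreal (dist (Y 0 w) (Y_lim w)) \<partial>P)"
    unfolding \<pi>_lim_def by (subst nn_integral_distr) (auto simp: Y_def dist_commute)
  also have "\<dots> < \<infinity>"
    using nn_integral_dist_Y_lim_le[of 0] by (simp add: le_less_trans)
  finally show ?thesis using \<pi>_lim_in_M1 unfolding M11_def by blast
qed

text \<open>The start is drawn from \<open>\<mu>\<close> independently of the sample, and the same
  sample drives the iterate and \<open>Y_lim\<close>. Passing through \<open>Y n\<close> splits
  their distance into a contraction term and a tail term.\<close>

lemma dBL_backward_le: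
  assumes "\<mu> \<in> M11"
  shows "dBL (backward \<Theta> S n \<mu>) \<pi>_lim \<le> R ^ n * ((\<integral>x. dist x x0 \<partial>\<mu>) + B / (1 - R))"
proof -
  have \<mu>: "\<mu> \<in> M1" and s[measurable_cong]: "sets \<mu> = sets borel" and p: "prob_space \<mu>"
    using assms by (auto simp: M11_def)
  interpret \<mu>: prob_space \<mu> by (rule p)
  note int = M11_integrable[OF assms, of x0]
  \<comment> \<open>The limit law is moved to the product space, so that both laws are images of one
    measure.\<close>
  have \<pi>: "\<pi>_lim = distr (\<mu> \<Otimes>\<^sub>M P) borel (\<lambda>z. Y_lim (snd z))"
  proof (rule measure_eqI)
    fix A assume "A \<in> sets \<pi>_lim"
    then have A[measurable]: "A \<in> sets borel" by (simp add: \<pi>_lim_def)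
    have "emeasure (distr (\<mu> \<Otimes>\<^sub>M P) borel (\<lambda>z. Y_lim (snd z))) A
        = (\<integral>\<^sup>+ x. \<integral>\<^sup>+ w. indicator A (Y_lim w) \<partial>P \<partial>\<mu>)"
      by (subst emeasure_distr_eq_nn_integral, simp_all, subst P.nn_integral_fst[symmetric]) auto
    then show "emeasure \<pi>_lim A = emeasure (distr (\<mu> \<Otimes>\<^sub>M P) borel (\<lambda>z. Y_lim (snd z))) A"
      by (simp add: \<pi>_lim_def emeasure_distr_eq_nn_integral \<mu>.emeasure_space_1)
  qed (simp add: \<pi>_lim_def)
  have "(\<integral>\<^sup>+ z. ennreal (dist (backward_map S n (snd z) (fst z)) (Y_lim (snd z))) \<partial>(\<mu> \<Otimes>\<^sub>M P))
      = (\<integral>\<^sup>+ x. \<integral>\<^sup>+ w. ennreal (dist (backward_map S n w x) (Y_lim w)) \<partial>P \<partial>\<mu>)"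
    by (subst P.nn_integral_fst[symmetric]) auto
  also have "\<dots> \<le> (\<integral>\<^sup>+ x. ennreal (R ^ n * dist x x0 + R ^ n * (B / (1 - R))) \<partial>\<mu>)"
  proof (rule nn_integral_mono)
    fix x
    have "(\<integral>\<^sup>+ w. ennreal (dist (backward_map S n w x) (Y_lim w)) \<partial>P)
        \<le> (\<integral>\<^sup>+ w. ennreal (dist (backward_map S n w x) (backward_map S n w x0))
          + ennreal (dist (Y n w) (Y_lim w)) \<partial>P)"
      by (intro nn_integral_mono)
        (auto simp: Y_def ennreal_plus[symmetric] dist_triangle simp del: ennreal_plus intro!: ennreal_leI)
    also have "\<dots> = (\<integral>\<^sup>+ w. ennreal (dist (backward_map S n w x) (backward_map S n w x0)) \<partial>P)
        + (\<integral>\<^sup>+ w. ennreal (dist (Y n w) (Y_lim w)) \<partial>P)"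
      by (intro nn_integral_add) auto
    also have "\<dots> \<le> ennreal (R ^ n * dist x x0) + ennreal (R ^ n * (B / (1 - R)))"
      by (intro add_mono nn_integral_dist_backward_map_le nn_integral_dist_Y_lim_le)
    also have "\<dots> = ennreal (R ^ n * dist x x0 + R ^ n * (B / (1 - R)))"
      using R B by (intro ennreal_plus[symmetric]) auto
    finally show "(\<integral>\<^sup>+ w. ennreal (dist (backward_map S n w x) (Y_lim w)) \<partial>P)
        \<le> ennreal (R ^ n * dist x x0 + R ^ n * (B / (1 - R)))" .
  qed
  also have "\<dots> = ennreal (R ^ n * ((\<integral>x. dist x x0 \<partial>\<mu>) + B / (1 - R)))"
    using int R B by (subst nn_integral_eq_integral) (auto simp: \<mu>.prob_space algebra_simps)
  finally have "(\<integral>\<^sup>+ z. ennreal (dist (case z of (x, w) \<Rightarrow> backward_map S n w x) (Y_lim (snd z)))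
      \<partial>(\<mu> \<Otimes>\<^sub>M P)) \<le> ennreal (R ^ n * ((\<integral>x. dist x x0 \<partial>\<mu>) + B / (1 - R)))"
    by (simp add: case_prod_beta')
  then show ?thesis
    unfolding backward_eq_distr[OF \<mu>] \<pi>
    using R B prob_space_pair[OF p P.prob_space_axioms] by (intro dBL_distr_le) auto
qed

lemma geometric_limit_\<pi>_lim: "geometric_limit \<Theta> S x0 \<pi>_lim"
  unfolding geometric_limit_def
proof (intro exI conjI ballI allI impI)
  \<comment> \<open>The locale allows \<open>R = 0\<close>, while the rate must be positive, hence
    the maximum with 1/2. The constant \<open>1 + ?D\<close> is chosen because (1 + D) (1 + I) = I +
    D + 1 + D I.\<close>
  let ?q = "max R (1 / 2)" and ?D = "B / (1 - R)"
  show "0 < ?q" "?q < 1" using R by auto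
  show "0 \<le> 1 + ?D" using R B by simp
  fix \<mu> :: "'a measure" and n :: nat
  assume \<mu>: "\<mu> \<in> M11"
  let ?I = "\<integral>x. dist x x0 \<partial>\<mu>"
  have I: "0 \<le> ?I" by simp
  have D: "0 \<le> ?D" using R B by simp
  have "?I + ?D \<le> (1 + ?D) * (1 + ?I)"
    using I D mult_nonneg_nonneg[OF D I] by (simp only: ring_distribs)
  then have "R ^ n * (?I + ?D) \<le> ?q ^ n * ((1 + ?D) * (1 + ?I))"
    using R I D by (intro mult_mono power_mono) auto
  then show "dBL (backward \<Theta> S n \<mu>) \<pi>_lim \<le> (1 + ?D) * ?q ^ n * (1 + ?I)"
    using dBL_backward_le[OF \<mu>, of n] by (simp add: mult_ac)
qed

section \<open>Uniqueness of the limit\<close>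

lemma return_in_M11: "return borel x0 \<in> M11"
  unfolding M11_def by (auto simp: prob_space_return nn_integral_return intro!: exI[of _ x0])

text \<open>For uniqueness one starting law suffices: the laws started from the point mass at
  \<open>x0\<close> do not depend on \<open>\<pi>\<close>, so their integrals of \<open>f\<close>
  fix the integral of \<open>f\<close> under \<open>\<pi>\<close>.\<close>

lemma geometric_limit_tendsto:
  assumes \<pi>: "\<pi> \<in> M1" "geometric_limit \<Theta> S x0 \<pi>" and f: "f \<in> BL1"
  shows "(\<lambda>n. \<integral>x. f x \<partial>backward \<Theta> S n (return borel x0)) \<longlonglongrightarrow> (\<integral>x. f x \<partial>\<pi>)"
proof -
  let ?\<nu> = "\<lambda>n. backward \<Theta> S n (return borel x0)"
  obtain q C where q: "0 < q" "q < 1"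
    and le: "\<And>\<mu> n. \<mu> \<in> M11 \<Longrightarrow> n \<ge> 1 \<Longrightarrow>
      dBL (backward \<Theta> S n \<mu>) \<pi> \<le> C * q ^ n * (1 + (\<integral>x. dist x x0 \<partial>\<mu>))"
    using \<pi>(2) unfolding geometric_limit_def by blast
  define K where "K = C * (1 + (\<integral>x. dist x x0 \<partial>return borel x0))"
  have \<nu>: "prob_space (?\<nu> n)" for n
    using backward_in_M1[of "return borel x0" n] by (simp add: prob_space_return)
  have "\<bar>(\<integral>x. f x \<partial>?\<nu> n) - (\<integral>x. f x \<partial>\<pi>)\<bar> \<le> K * q ^ n" if "n \<ge> 1" for n
    using BL1_diff_le_dBL[OF \<nu>[of n] _ f, of \<pi>] le[OF return_in_M11 that] \<pi>(1)
    by (simp add: K_def mult_ac)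
  then have "\<forall>\<^sub>F n in sequentially. norm ((\<integral>x. f x \<partial>?\<nu> n) - (\<integral>x. f x \<partial>\<pi>)) \<le> K * q ^ n"
    unfolding eventually_sequentially by (intro exI[of _ 1]) auto
  moreover have "(\<lambda>n. K * q ^ n) \<longlonglongrightarrow> 0"
    using q by (intro tendsto_mult_right_zero LIMSEQ_realpow_zero) auto
  ultimately show ?thesis
    by (rule Lim_null[THEN iffD2, OF Lim_null_comparison])
qed

lemma geometric_limit_unique:
  assumes "\<pi> \<in> M1" "geometric_limit \<Theta> S x0 \<pi>"
  shows "\<pi> = \<pi>_lim"
proof (rule measure_eqI_BL1[OF assms(1) \<pi>_lim_in_M1])
  show "(\<integral>x. f x \<partial>\<pi>) = (\<integral>x. f x \<partial>\<pi>_lim)" if "f \<in> BL1" for f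
    using geometric_limit_tendsto[OF assms that]
      geometric_limit_tendsto[OF \<pi>_lim_in_M1 geometric_limit_\<pi>_lim that]
    by (rule LIMSEQ_unique)
qed

end

section \<open>From the hypotheses to contraction on average\<close>

text \<open>Both integrals are computed from the common law on the positive half-line. In this
  nonnegative form the mean of \<open>L 1\<close> carries over to every \<open>L n\<close>, and
  integrability of \<open>L n\<close> comes out of it.\<close>

lemma nn_integral_eq_of_same_law:
  assumes M: "prob_space M" and N: "prob_space N"
    and f: "f \<in> M \<rightarrow>\<^sub>M restrict_space borel {0<..}" and g: "g \<in> N \<rightarrow>\<^sub>M restrict_space borel {0<..}"
    and law: "\<And>E. E \<in> sets (restrict_space borel {0<..}) \<Longrightarrow>
      measure M (f -` E \<inter> space M) = measure N (g -` E \<inter> space N)"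
  shows "(\<integral>\<^sup>+ x. ennreal (f x) \<partial>M) = (\<integral>\<^sup>+ x. ennreal (g x) \<partial>N)"
proof -
  let ?B = "restrict_space borel {0<..} :: real measure"
  interpret M: prob_space M by fact
  interpret N: prob_space N by fact
  have "distr M ?B f = distr N ?B g"
    using f g law
    by (intro measure_eqI) (auto simp: emeasure_distr M.emeasure_eq_measure N.emeasure_eq_measure)
  moreover have "ennreal \<in> borel_measurable ?B"
    by (intro measurable_restrict_space1) measurable
  ultimately show ?thesis
    using nn_integral_distr[OF f, of ennreal] nn_integral_distr[OF g, of ennreal] by simp
qed

theorem proposition3p1:
  fixes \<Theta> :: "nat \<Rightarrow> 't measure"
    and S :: "nat \<Rightarrow> 't \<Rightarrow> 'a::polish_space \<Rightarrow> 'a"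
    and L :: "nat \<Rightarrow> 't \<Rightarrow> real"
    and x0 :: 'a
  assumes prob: "\<And>n. n \<ge> 1 \<Longrightarrow> prob_space (\<Theta> n)"
    and S_meas: "\<And>n. n \<ge> 1 \<Longrightarrow> (\<lambda>(x, \<theta>). S n \<theta> x) \<in> borel \<Otimes>\<^sub>M \<Theta> n \<rightarrow>\<^sub>M borel"
    and L_meas: "\<And>n. n \<ge> 1 \<Longrightarrow> L n \<in> \<Theta> n \<rightarrow>\<^sub>M restrict_space borel {0<..}"
    and A1: "\<And>n. n \<ge> 1 \<Longrightarrow>
      AE \<theta> in \<Theta> n. \<forall>x y. dist (S n \<theta> x) (S n \<theta> y) \<le> L n \<theta> * dist x y"
    and A2_law: "\<And>n m E. n \<ge> 1 \<Longrightarrow> m \<ge> 1 \<Longrightarrow> E \<in> sets (restrict_space borel {0<..}) \<Longrightarrow>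
      measure (\<Theta> n) (L n -` E \<inter> space (\<Theta> n)) = measure (\<Theta> m) (L m -` E \<inter> space (\<Theta> m))"
    and A2_R: "integrable (\<Theta> 1) (L 1)"
    and A2_ln: "ext_integral (\<Theta> 1) (\<lambda>\<theta>. ln (L 1 \<theta>)) < 0"
    and A3': "(SUP n\<in>{1..}. \<integral>\<^sup>+ \<theta>. ennreal (dist x0 (S n \<theta> x0)) \<partial>\<Theta> n) < \<infinity>"
    and R_less_1: "(\<integral>\<theta>. L 1 \<theta> \<partial>\<Theta> 1) < 1"
  shows "(\<exists>!\<pi>. \<pi> \<in> M1 \<and> geometric_limit \<Theta> S x0 \<pi>) \<and>
         (\<forall>\<pi>. \<pi> \<in> M1 \<and> geometric_limit \<Theta> S x0 \<pi> \<longrightarrow> \<pi> \<in> M11)"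
proof -
  let ?R = "\<integral>\<theta>. L 1 \<theta> \<partial>\<Theta> 1"
  let ?B = "SUP n\<in>{1..}. \<integral>\<^sup>+ \<theta>. ennreal (dist x0 (S n \<theta> x0)) \<partial>\<Theta> n"
  have L_pos: "0 < L n \<theta>" if "n \<ge> 1" "\<theta> \<in> space (\<Theta> n)" for n \<theta>
    using measurable_space[OF L_meas[OF that(1)] that(2)] by (simp add: space_restrict_space)
  have L_borel: "L n \<in> borel_measurable (\<Theta> n)" if "n \<ge> 1" for n
    using L_meas[OF that] by (simp add: measurable_restrict_space2_iff)
  have nn_L: "(\<integral>\<^sup>+ \<theta>. ennreal (L n \<theta>) \<partial>\<Theta> n) = ennreal ?R" if "n \<ge> 1" for n
  proof -
    have "(\<integral>\<^sup>+ \<theta>. ennreal (L n \<theta>) \<partial>\<Theta> n) = (\<integral>\<^sup>+ \<theta>. ennreal (L 1 \<theta>) \<partial>\<Theta> 1)"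
      using that by (intro nn_integral_eq_of_same_law prob L_meas A2_law) auto
    also have "\<dots> = ennreal ?R"
      using L_pos[of 1] by (intro nn_integral_eq_integral A2_R) (auto intro!: AE_I2 less_imp_le)
    finally show ?thesis .
  qed
  \<comment> \<open>The supremum is finite by \<open>A3'\<close>, so \<open>enn2real\<close>
    preserves its value.\<close>
  interpret contracting_on_average \<Theta> S ?R "enn2real ?B" x0
  proof (rule contracting_on_average.intro)
    fix n and x y :: 'a
    show "prob_space (\<Theta> (Suc n))"
      and "(\<lambda>(x, \<theta>). S (Suc n) \<theta> x) \<in> borel \<Otimes>\<^sub>M \<Theta> (Suc n) \<rightarrow>\<^sub>M borel"
      using prob S_meas by auto
    show "0 \<le> ?R"
      using L_pos[of 1] by (intro integral_nonneg_AE) (auto intro!: AE_I2 less_imp_le)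
    show "?R < 1" by (rule R_less_1)
    show "0 \<le> enn2real ?B" by simp
    have "(\<integral>\<^sup>+ \<theta>. ennreal (dist (S (Suc n) \<theta> x) (S (Suc n) \<theta> y)) \<partial>\<Theta> (Suc n))
        \<le> (\<integral>\<^sup>+ \<theta>. ennreal (L (Suc n) \<theta>) * ennreal (dist x y) \<partial>\<Theta> (Suc n))"
      using A1[of "Suc n"] L_pos[of "Suc n"]
      by (intro nn_integral_mono_AE)
        (auto simp: ennreal_mult'[symmetric] less_imp_le intro!: ennreal_leI)
    also have "\<dots> = ennreal (?R * dist x y)"
      using L_borel[of "Suc n"] nn_L[of "Suc n"]
      by (simp add: nn_integral_multc ennreal_mult'')
    finally show "(\<integral>\<^sup>+ \<theta>. ennreal (dist (S (Suc n) \<theta> x) (S (Suc n) \<theta> y)) \<partial>\<Theta> (Suc n))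
        \<le> ennreal (?R * dist x y)" .
    have "(\<integral>\<^sup>+ \<theta>. ennreal (dist x0 (S (Suc n) \<theta> x0)) \<partial>\<Theta> (Suc n)) \<le> ?B"
      by (rule SUP_upper) simp
    then show "(\<integral>\<^sup>+ \<theta>. ennreal (dist x0 (S (Suc n) \<theta> x0)) \<partial>\<Theta> (Suc n)) \<le> ennreal (enn2real ?B)"
      using A3' by simp
  qed
  \<comment> \<open>By uniqueness every measure with the geometric bound is
    \<open>\<pi>_lim\<close>, whose first moment is finite.\<close>
  show ?thesis
    using \<pi>_lim_in_M1 \<pi>_lim_in_M11 geometric_limit_\<pi>_lim geometric_limit_unique by blast
qed

end
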